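(* Let $G$ be an abelian group (written additively), let $\alpha\in\mathrm{Aut}(G)$ satisfy $\alpha^2=1$, and let $G_\alpha=(G,\cdot)$ be the AG-group with operation $a\cdot b:=\alpha(a)+b$. Then $G_\alpha$ is involutory if and only if $\alpha$ is the minus identity automorphism, that is, $\alpha(g)=-g$ for all $g\in G$. In particular, there is a natural bijection between abelian groups and involutory AG-groups, given by $G\mapsto G_{-1}$, where $-1$ denotes the automorphism $g\mapsto -g$ of $G$.
   Context: An AG-group is a set $G$ with a binary operation (written as juxtaposition) that satisfies the left invertive law $(xy)z=(zy)x$ for all $x,y,z\in G$, has a left identity $e$ (so $ex=x$ for all $x\in G$), and has left inverses (for every $x\in G$ there is $x^{-1}\in G$ with $x^{-1}x=e$). For every abelian group $G$ and every $\alpha\in\mathrm{Aut}(G)$ with $\alpha^2=1$, $G_\alpha$ is an AG-group with left identity $0$. An AG-group is called involutory if every element $a$ satisfies $a^2=e$, where $e$ is the left identity. *)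

theory Defs
  imports "HOL-Algebra.Bij"
begin

locale AG_group =
  fixes G (structure)
  assumes m_closed: "\<lbrakk>x \<in> carrier G; y \<in> carrier G\<rbrakk> \<Longrightarrow> x \<otimes> y \<in> carrier G"
    and left_invertive:
      "\<lbrakk>x \<in> carrier G; y \<in> carrier G; z \<in> carrier G\<rbrakk> \<Longrightarrow> (x \<otimes> y) \<otimes> z = (z \<otimes> y) \<otimes> x"
    and one_closed: "\<one> \<in> carrier G"
    and l_one: "x \<in> carrier G \<Longrightarrow> \<one> \<otimes> x = x"
    and l_inv_ex: "x \<in> carrier G \<Longrightarrow> \<exists>y\<in>carrier G. y \<otimes> x = \<one>"

locale involutory_AG_group = AG_group +
  assumes square_one: "a \<in> carrier G \<Longrightarrow> a \<otimes> a = \<one>"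

(* Abelian groups are comm_group records, so the paper's 0, + and - are written \<one>, \<otimes> and inv.
   Outside the carrier the product of the twisted structure is set to undefined, so that the record
   is determined by the mathematical structure on the carrier. *)
definition AG_twist :: "('a, 'm) monoid_scheme \<Rightarrow> ('a \<Rightarrow> 'a) \<Rightarrow> 'a monoid" where
  "AG_twist G \<alpha> =
     \<lparr>carrier = carrier G,
      mult = (\<lambda>a b. if a \<in> carrier G \<and> b \<in> carrier G then \<alpha> a \<otimes>\<^bsub>G\<^esub> b else undefined),
      one = \<one>\<^bsub>G\<^esub>\<rparr>"

(* Restricted to the carrier because members of auto G are extensional. *)
definition minus_id :: "('a, 'm) monoid_scheme \<Rightarrow> 'a \<Rightarrow> 'a" where
  "minus_id G = (\<lambda>g\<in>carrier G. inv\<^bsub>G\<^esub> g)"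

(* A record also fixes the values of its product outside the carrier, which carry no mathematical
   content. Requiring them to be undefined makes two records equal exactly when they have the same
   carrier, the same product on it and the same identity. *)
definition extensional_mult :: "('a, 'm) monoid_scheme \<Rightarrow> bool" where
  "extensional_mult G \<longleftrightarrow>
     (\<lambda>(a, b). a \<otimes>\<^bsub>G\<^esub> b) \<in> extensional (carrier G \<times> carrier G)"

definition abelian_groups :: "'a monoid set" where
  "abelian_groups = {G. comm_group G \<and> extensional_mult G}"

definition involutory_AG_groups :: "'a monoid set" where
  "involutory_AG_groups = {G. involutory_AG_group G \<and> extensional_mult G}"

lemma AG_group_AG_twist:
  assumes "comm_group G" and "\<alpha> \<in> auto G" and "\<forall>g\<in>carrier G. \<alpha> (\<alpha> g) = g"
  shows "AG_group (AG_twist G \<alpha>)"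
proof -
  interpret comm_group G by fact
  have h: "\<alpha> \<in> hom G G" using assms(2) by (simp add: auto_def)
  have c: "\<And>x. x \<in> carrier G \<Longrightarrow> \<alpha> x \<in> carrier G" using h by (auto simp: hom_def)
  have m: "\<And>x y. x \<in> carrier G \<Longrightarrow> y \<in> carrier G \<Longrightarrow> \<alpha> (x \<otimes>\<^bsub>G\<^esub> y) = \<alpha> x \<otimes>\<^bsub>G\<^esub> \<alpha> y"
    using h by (auto simp: hom_def)
  have o: "\<alpha> \<one>\<^bsub>G\<^esub> = \<one>\<^bsub>G\<^esub>" using hom_one[OF h] is_group by blast
  show ?thesis
  proof (unfold_locales, goal_cases)
    case (5 x)
    then have "\<alpha> (inv\<^bsub>G\<^esub> (\<alpha> (x))) \<in> carrier G" "inv\<^bsub>G\<^esub> (\<alpha> x) \<in> carrier G"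
      by (auto simp: AG_twist_def c)
    moreover have "\<alpha> (inv\<^bsub>G\<^esub> (\<alpha> x)) \<otimes>\<^bsub>G\<^esub> x = \<one>\<^bsub>G\<^esub>"
    proof -
      have x: "x \<in> carrier G" using 5 by (simp add: AG_twist_def)
      have "\<alpha> (inv\<^bsub>G\<^esub> (\<alpha> x)) \<otimes>\<^bsub>G\<^esub> \<alpha> (\<alpha> x) = \<alpha> (inv\<^bsub>G\<^esub> (\<alpha> x) \<otimes>\<^bsub>G\<^esub> \<alpha> x)"
        using m[of "inv\<^bsub>G\<^esub> (\<alpha> x)" "\<alpha> x"] x by (simp add: c)
      then show ?thesis using x assms(3) by (simp add: c o)
    qed
    ultimately show ?case using 5 by (auto simp: AG_twist_def)
  qed (use assms(3) in \<open>auto simp: AG_twist_def c m o m_ac\<close>)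
qed

lemma minus_id_auto:
  assumes "comm_group G"
  shows "minus_id G \<in> auto G"
proof -
  interpret comm_group G by fact
  have "bij_betw (minus_id G) (carrier G) (carrier G)"
    by (rule bij_betw_byWitness[where f' = "minus_id G"]) (auto simp: minus_id_def)
  then show ?thesis
    by (auto simp: auto_def Bij_def hom_def minus_id_def inv_mult)
qed

end

theory Submission
  imports Defs
begin

text \<open>
  In \<open>G\<^sub>\<alpha>\<close> the square of \<open>a\<close> is \<open>\<alpha>(a) + a\<close>, so all squares are trivial exactly when \<open>\<alpha>\<close> is
  negation. For the bijection, addition must be recovered from the product of an involutory
  AG-group alone. In \<open>G\<^sub>\<alpha>\<close> one has \<open>a \<cdot> 0 = \<alpha>(a)\<close>, and \<open>\<alpha>\<close> is an involution, so
  \<open>(a \<cdot> 0) \<cdot> b = a + b\<close>. Accordingly, \<open>AG_untwist\<close> equips an arbitrary AG-group with the addition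
  \<open>a + b = (a \<cdot> e) \<cdot> b\<close>; the left invertive law turns this into an abelian group
  (\<open>comm_group_AG_untwist\<close>), in which \<open>a \<cdot> e\<close> is the negative of \<open>a\<close> as soon as all squares
  are trivial. The two constructions are then mutually inverse.

  The bijection is natural because \<open>G\<close> and \<open>G\<^bsub>-1\<^esub>\<close> have the same homomorphisms: the operation
  \<open>-a + b\<close> determines the zero, the negation and the addition by \<open>0 = -a + a\<close>,
  \<open>-a = -a + 0\<close> and \<open>a + b = -(-a) + b\<close>.
\<close>

lemma carrier_AG_twist [simp]: "carrier (AG_twist G \<alpha>) = carrier G"
  by (simp add: AG_twist_def)

lemma one_AG_twist [simp]: "\<one>\<^bsub>AG_twist G \<alpha>\<^esub> = \<one>\<^bsub>G\<^esub>"
  by (simp add: AG_twist_def)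

lemma mult_AG_twist [simp]:
  "\<lbrakk>a \<in> carrier G; b \<in> carrier G\<rbrakk> \<Longrightarrow> a \<otimes>\<^bsub>AG_twist G \<alpha>\<^esub> b = \<alpha> a \<otimes>\<^bsub>G\<^esub> b"
  by (simp add: AG_twist_def)

lemma extensional_mult_AG_twist: "extensional_mult (AG_twist G \<alpha>)"
  by (auto simp: extensional_mult_def extensional_def AG_twist_def)

lemma minus_id_apply [simp]: "g \<in> carrier G \<Longrightarrow> minus_id G g = inv\<^bsub>G\<^esub> g"
  by (simp add: minus_id_def)

lemma monoid_eqI_extensional_mult:
  fixes G H :: "'a monoid"
  assumes "extensional_mult G" "extensional_mult H"
    and "carrier G = carrier H" "\<one>\<^bsub>G\<^esub> = \<one>\<^bsub>H\<^esub>"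
    and "\<And>a b. \<lbrakk>a \<in> carrier G; b \<in> carrier G\<rbrakk> \<Longrightarrow> a \<otimes>\<^bsub>G\<^esub> b = a \<otimes>\<^bsub>H\<^esub> b"
  shows "G = H"
proof -
  have "(\<lambda>(a, b). a \<otimes>\<^bsub>G\<^esub> b) = (\<lambda>(a, b). a \<otimes>\<^bsub>H\<^esub> b)"
    by (rule extensionalityI[where A = "carrier G \<times> carrier G"])
      (use assms in \<open>auto simp: extensional_mult_def\<close>)
  then have "mult G = mult H"
    by (simp add: fun_eq_iff)
  then show ?thesis
    using assms(3,4) by (intro monoid.equality) simp_all
qed

theorem involutory_AG_twist_iff:
  assumes "comm_group G" and "\<alpha> \<in> auto G" and "\<forall>g\<in>carrier G. \<alpha> (\<alpha> g) = g"
  shows "involutory_AG_group (AG_twist G \<alpha>) \<longleftrightarrow> (\<forall>g\<in>carrier G. \<alpha> g = inv\<^bsub>G\<^esub> g)"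
proof -
  interpret comm_group G by fact
  have closed: "\<alpha> g \<in> carrier G" if "g \<in> carrier G" for g
    using assms(2) that by (auto simp: auto_def hom_def)
  have "involutory_AG_group (AG_twist G \<alpha>) \<longleftrightarrow> (\<forall>g\<in>carrier G. \<alpha> g \<otimes>\<^bsub>G\<^esub> g = \<one>\<^bsub>G\<^esub>)"
    using AG_group_AG_twist[OF assms]
    by (simp add: involutory_AG_group_def involutory_AG_group_axioms_def Ball_def)
  also have "\<dots> \<longleftrightarrow> (\<forall>g\<in>carrier G. \<alpha> g = inv\<^bsub>G\<^esub> g)"
    using closed by (metis inv_equality l_inv)
  finally show ?thesis .
qed

corollary involutory_AG_twist_minus_id:
  assumes "comm_group G"
  shows "involutory_AG_group (AG_twist G (minus_id G))"
proof -
  interpret comm_group G by fact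
  show ?thesis
    using involutory_AG_twist_iff[OF assms minus_id_auto[OF assms]] by simp
qed

definition AG_untwist :: "('a, 'm) monoid_scheme \<Rightarrow> 'a monoid" where
  "AG_untwist A =
     \<lparr>carrier = carrier A,
      mult = (\<lambda>a b. if a \<in> carrier A \<and> b \<in> carrier A
                     then (a \<otimes>\<^bsub>A\<^esub> \<one>\<^bsub>A\<^esub>) \<otimes>\<^bsub>A\<^esub> b else undefined),
      one = \<one>\<^bsub>A\<^esub>\<rparr>"

lemma carrier_AG_untwist [simp]: "carrier (AG_untwist A) = carrier A"
  by (simp add: AG_untwist_def)

lemma one_AG_untwist [simp]: "\<one>\<^bsub>AG_untwist A\<^esub> = \<one>\<^bsub>A\<^esub>"
  by (simp add: AG_untwist_def)

lemma mult_AG_untwist [simp]: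
  "\<lbrakk>a \<in> carrier A; b \<in> carrier A\<rbrakk> \<Longrightarrow> a \<otimes>\<^bsub>AG_untwist A\<^esub> b = (a \<otimes>\<^bsub>A\<^esub> \<one>\<^bsub>A\<^esub>) \<otimes>\<^bsub>A\<^esub> b"
  by (simp add: AG_untwist_def)

lemma extensional_mult_AG_untwist: "extensional_mult (AG_untwist A)"
  by (auto simp: extensional_mult_def extensional_def AG_untwist_def)

context AG_group
begin

text \<open>Immediate from the left invertive law and \<open>\<one> \<otimes> \<one> = \<one>\<close>: right multiplication by the left
  identity plays the part of the automorphism \<open>\<alpha>\<close>, whose square is the identity.\<close>

lemma right_one_involution:
  assumes "x \<in> carrier G"
  shows "(x \<otimes> \<one>) \<otimes> \<one> = x"
  using assms left_invertive[of x \<one> \<one>] by (simp add: l_one one_closed)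

lemma medial:
  assumes "a \<in> carrier G" "b \<in> carrier G" "c \<in> carrier G" "d \<in> carrier G"
  shows "(a \<otimes> b) \<otimes> (c \<otimes> d) = (a \<otimes> c) \<otimes> (b \<otimes> d)"
proof -
  have "(a \<otimes> b) \<otimes> (c \<otimes> d) = ((c \<otimes> d) \<otimes> b) \<otimes> a"
    using assms by (intro left_invertive m_closed)
  also have "\<dots> = ((b \<otimes> d) \<otimes> c) \<otimes> a"
    using assms by (simp add: left_invertive[of c d b])
  also have "\<dots> = (a \<otimes> c) \<otimes> (b \<otimes> d)"
    using assms by (intro left_invertive m_closed)
  finally show ?thesis .
qed

text \<open>The medial law applied to \<open>(\<one> \<otimes> a) \<otimes> (b \<otimes> c)\<close>. This is the substitute for associativity
  that makes the untwisted operation associative.\<close>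

lemma left_commute:
  assumes "a \<in> carrier G" "b \<in> carrier G" "c \<in> carrier G"
  shows "a \<otimes> (b \<otimes> c) = b \<otimes> (a \<otimes> c)"
  using assms medial[of \<one> a b c] by (simp add: l_one one_closed)

text \<open>Commutativity of the untwisted operation is the left invertive law with the left identity in
  the middle. Given commutativity, associativity amounts to exchanging the two outer summands of
  \<open>z + (x + y)\<close>, which is left commutativity of the product.\<close>

lemma comm_group_AG_untwist: "comm_group (AG_untwist G)"
proof (rule comm_groupI)
  have comm: "(x \<otimes> \<one>) \<otimes> y = (y \<otimes> \<one>) \<otimes> x" if "x \<in> carrier G" "y \<in> carrier G" for x y
    using that by (intro left_invertive one_closed)
  fix x y assume x: "x \<in> carrier (AG_untwist G)" and y: "y \<in> carrier (AG_untwist G)"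
  show "x \<otimes>\<^bsub>AG_untwist G\<^esub> y \<in> carrier (AG_untwist G)"
    using x y by (simp add: m_closed one_closed)
  show "x \<otimes>\<^bsub>AG_untwist G\<^esub> y = y \<otimes>\<^bsub>AG_untwist G\<^esub> x"
    using x y by (simp add: comm)
  fix z assume z: "z \<in> carrier (AG_untwist G)"
  have "(((x \<otimes> \<one>) \<otimes> y) \<otimes> \<one>) \<otimes> z = (z \<otimes> \<one>) \<otimes> ((x \<otimes> \<one>) \<otimes> y)"
    using x y z by (intro comm) (simp_all add: m_closed one_closed)
  also have "\<dots> = (x \<otimes> \<one>) \<otimes> ((z \<otimes> \<one>) \<otimes> y)"
    using x y z by (intro left_commute) (simp_all add: m_closed one_closed)
  also have "\<dots> = (x \<otimes> \<one>) \<otimes> ((y \<otimes> \<one>) \<otimes> z)"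
    using y z comm[of z y] by simp
  finally show "(x \<otimes>\<^bsub>AG_untwist G\<^esub> y) \<otimes>\<^bsub>AG_untwist G\<^esub> z =
      x \<otimes>\<^bsub>AG_untwist G\<^esub> (y \<otimes>\<^bsub>AG_untwist G\<^esub> z)"
    using x y z by (simp add: m_closed one_closed)
next
  fix x assume x: "x \<in> carrier (AG_untwist G)"
  then show "\<one>\<^bsub>AG_untwist G\<^esub> \<otimes>\<^bsub>AG_untwist G\<^esub> x = x"
    by (simp add: one_closed l_one)
  obtain y where y: "y \<in> carrier G" "y \<otimes> x = \<one>"
    using l_inv_ex[of x] x by auto
  \<comment> \<open>The additive inverse is \<open>y \<otimes> \<one>\<close> and not \<open>y\<close>, because addition applies the involution once more.\<close>
  have "(y \<otimes> \<one>) \<otimes>\<^bsub>AG_untwist G\<^esub> x = \<one>"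
    using x y by (simp add: m_closed one_closed right_one_involution)
  then show "\<exists>y\<in>carrier (AG_untwist G). y \<otimes>\<^bsub>AG_untwist G\<^esub> x = \<one>\<^bsub>AG_untwist G\<^esub>"
    using y(1) by (auto intro: bexI[of _ "y \<otimes> \<one>"] simp: m_closed one_closed)
qed (simp add: one_closed)

end

lemma (in involutory_AG_group) inv_AG_untwist:
  assumes "x \<in> carrier G"
  shows "inv\<^bsub>AG_untwist G\<^esub> x = x \<otimes> \<one>"
proof -
  interpret U: comm_group "AG_untwist G"
    by (rule comm_group_AG_untwist)
  show ?thesis
    using assms
    by (intro U.inv_equality) (simp_all add: m_closed one_closed right_one_involution square_one)
qed

lemma AG_untwist_AG_twist:
  fixes G :: "'a monoid"
  assumes "comm_group G" "extensional_mult G"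
  shows "AG_untwist (AG_twist G (minus_id G)) = G"
proof -
  interpret comm_group G by fact
  show ?thesis
    using assms(2)
    by (intro monoid_eqI_extensional_mult extensional_mult_AG_untwist) simp_all
qed

lemma AG_twist_AG_untwist:
  fixes A :: "'a monoid"
  assumes "involutory_AG_group A" "extensional_mult A"
  shows "AG_twist (AG_untwist A) (minus_id (AG_untwist A)) = A"
proof -
  interpret involutory_AG_group A by fact
  show ?thesis
    using assms(2)
    by (intro monoid_eqI_extensional_mult extensional_mult_AG_twist)
      (simp_all add: inv_AG_untwist m_closed one_closed right_one_involution)
qed

theorem bij_betw_AG_twist_minus_id:
  "bij_betw (\<lambda>G. AG_twist G (minus_id G))
     (abelian_groups :: 'a monoid set) (involutory_AG_groups :: 'a monoid set)"
  by (rule bij_betw_byWitness[where f' = AG_untwist])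
    (auto simp: abelian_groups_def involutory_AG_groups_def AG_untwist_AG_twist
      AG_twist_AG_untwist involutory_AG_twist_minus_id extensional_mult_AG_twist
      extensional_mult_AG_untwist AG_group.comm_group_AG_untwist
      dest: involutory_AG_group.axioms(1))

theorem hom_AG_twist_minus_id:
  assumes "comm_group G" "comm_group H"
  shows "hom (AG_twist G (minus_id G)) (AG_twist H (minus_id H)) = hom G H"
    (is "hom ?G ?H = _")
proof
  interpret G: comm_group G by fact
  interpret H: comm_group H by fact
  show "hom G H \<subseteq> hom ?G ?H"
  proof
    fix h assume h: "h \<in> hom G H"
    then interpret group_hom G H h
      by unfold_locales
    show "h \<in> hom ?G ?H"
      by (rule homI) simp_all
  qed
  show "hom ?G ?H \<subseteq> hom G H"
  proof
    fix h assume h: "h \<in> hom ?G ?H"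
    have closed: "h a \<in> carrier H" if "a \<in> carrier G" for a
      using h that by (auto simp: hom_def)
    have diff: "h (inv\<^bsub>G\<^esub> a \<otimes>\<^bsub>G\<^esub> b) = inv\<^bsub>H\<^esub> (h a) \<otimes>\<^bsub>H\<^esub> h b"
      if "a \<in> carrier G" "b \<in> carrier G" for a b
      using hom_mult[OF h, of a b] that closed by simp
    have one: "h \<one>\<^bsub>G\<^esub> = \<one>\<^bsub>H\<^esub>"
      using diff[of "\<one>\<^bsub>G\<^esub>" "\<one>\<^bsub>G\<^esub>"] closed[of "\<one>\<^bsub>G\<^esub>"] by simp
    have minus: "h (inv\<^bsub>G\<^esub> a) = inv\<^bsub>H\<^esub> (h a)" if "a \<in> carrier G" for a
      using diff[of a "\<one>\<^bsub>G\<^esub>"] that closed one by simp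
    show "h \<in> hom G H"
    proof (rule homI)
      fix a b assume "a \<in> carrier G" "b \<in> carrier G"
      then show "h (a \<otimes>\<^bsub>G\<^esub> b) = h a \<otimes>\<^bsub>H\<^esub> h b"
        using diff[of "inv\<^bsub>G\<^esub> a" b] closed minus by simp
    qed (rule closed)
  qed
qed

theorem theorem2:
  shows "(\<forall>(G :: 'a monoid) \<alpha>.
            comm_group G \<and> \<alpha> \<in> auto G \<and> (\<forall>g\<in>carrier G. \<alpha> (\<alpha> g) = g) \<longrightarrow>
            (involutory_AG_group (AG_twist G \<alpha>) \<longleftrightarrow> (\<forall>g\<in>carrier G. \<alpha> g = inv\<^bsub>G\<^esub> g)))
       \<and> bij_betw (\<lambda>G. AG_twist G (minus_id G))
           (abelian_groups :: 'a monoid set) (involutory_AG_groups :: 'a monoid set)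
       \<and> (\<forall>(G :: 'a monoid) (H :: 'b monoid). comm_group G \<and> comm_group H \<longrightarrow>
            iso G H = iso (AG_twist G (minus_id G)) (AG_twist H (minus_id H)))"
  using involutory_AG_twist_iff bij_betw_AG_twist_minus_id
  by (auto simp: iso_def hom_AG_twist_minus_id)

end
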